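(* Let $n\ge 1$ and let $\mathcal{C}_n$ be the set of all convex bodies in $\mathbb{R}^n$. The three metric topologies on $\mathcal{C}_n$ determined by the distance functions $d^W$, $d^V$ and $d^H$ coincide with each other.
   Context: A convex body in $\mathbb{R}^n$ is a (nonempty) bounded closed convex subset of $\mathbb{R}^n$ which is the closure of an open subset of $\mathbb{R}^n$ (equivalently, a compact convex set with nonempty interior). For a convex body $C$ let $m_C:=\frac{\chi_C}{\mathcal{H}^n(C)}\mathcal{H}^n$ be the normalized $n$-dimensional Hausdorff (equivalently, Lebesgue) measure on $C$, a Borel probability measure on $\mathbb{R}^n$. The three distance functions on $\mathcal{C}_n$ are: (i) $d^W(C_1,C_2):=W_2(m_{C_1},m_{C_2})$, where $W_2$ is the $L^2$-Wasserstein distance on Borel probability measures on $\mathbb{R}^n$ with finite second moment: $W_2(m,m')=\inf_\xi\left(\int_{\mathbb{R}^n\times\mathbb{R}^n}\|x-y\|^2\,\xi(dx,dy)\right)^{1/2}$, the infimum being over all Borel probability measures $\xi$ on $\mathbb{R}^n\times\mathbb{R}^n$ with first marginal $m$ and second marginal $m'$; (ii) $d^V(C_1,C_2):=|C_1\bigtriangleup C_2|$, the Lebesgue measure of the symmetric difference; (iii) $d^H$, the Hausdorff distance with respect to the Euclidean norm: $d^H(C_1,C_2)=\max\{\max_{x\in C_1}\min_{y\in C_2}\|x-y\|,\ \max_{y\in C_2}\min_{x\in C_1}\|x-y\|\}$. *)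

theory Defs
  imports "HOL-Probability.Probability"
begin

definition convex_bodies :: "'a::euclidean_space set set" where
  "convex_bodies =
     {C. C \<noteq> {} \<and> bounded C \<and> closed C \<and> convex C \<and> (\<exists>U. open U \<and> C = closure U)}"

definition couplings :: "'a::euclidean_space measure \<Rightarrow> 'a measure \<Rightarrow> ('a \<times> 'a) measure set" where
  "couplings m m' =
     {\<xi>. prob_space \<xi> \<and> sets \<xi> = sets borel \<and> distr \<xi> borel fst = m \<and> distr \<xi> borel snd = m'}"

(* Meaningful for Borel probability measures with finite second moment. For these the set of
   couplings is nonempty, and the Bochner integral below is a genuine finite integral
   (lemma integrable_coupling_cost). *)
definition W2 :: "'a::euclidean_space measure \<Rightarrow> 'a measure \<Rightarrow> real" where
  "W2 m m' = (INF \<xi>\<in>couplings m m'. sqrt (LINT z|\<xi>. (norm (fst z - snd z))\<^sup>2))"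

definition wasserstein_dist :: "'a::euclidean_space set \<Rightarrow> 'a set \<Rightarrow> real" where
  "wasserstein_dist C1 C2 = W2 (uniform_measure lborel C1) (uniform_measure lborel C2)"

definition volume_dist :: "'a::euclidean_space set \<Rightarrow> 'a set \<Rightarrow> real" where
  "volume_dist C1 C2 = measure lborel (sym_diff C1 C2)"

(* For nonempty compact sets the suprema, and the infima in infdist, are attained. *)
definition hausdorff_dist :: "'a::euclidean_space set \<Rightarrow> 'a set \<Rightarrow> real" where
  "hausdorff_dist C1 C2 = max (SUP x\<in>C1. infdist x C2) (SUP y\<in>C2. infdist y C1)"

lemma integrable_coupling_cost:
  fixes m m' :: "'a::euclidean_space measure"
  assumes "\<xi> \<in> couplings m m'"
    and "integrable m (\<lambda>x. (norm x)\<^sup>2)" and "integrable m' (\<lambda>x. (norm x)\<^sup>2)"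
  shows "integrable \<xi> (\<lambda>z. (norm (fst z - snd z))\<^sup>2)"
proof -
  have s[measurable_cong]: "sets \<xi> = sets (borel :: ('a \<times> 'a) measure)"
    and m: "m = distr \<xi> borel fst" and m': "m' = distr \<xi> borel snd"
    using assms(1) by (auto simp: couplings_def)
  have f: "fst \<in> measurable \<xi> (borel :: 'a measure)"
    and g: "snd \<in> measurable \<xi> (borel :: 'a measure)"
    unfolding measurable_cong_sets[OF s refl]
    by (auto intro!: borel_measurable_continuous_onI continuous_intros)
  have "integrable \<xi> (\<lambda>z. (norm (fst z))\<^sup>2)" "integrable \<xi> (\<lambda>z. (norm (snd z))\<^sup>2)"
    using assms(2,3) f g unfolding m m' by (simp_all add: integrable_distr_eq)
  then have i: "integrable \<xi> (\<lambda>z. 2 * (norm (fst z))\<^sup>2 + 2 * (norm (snd z))\<^sup>2)"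
    by auto
  have bound: "(norm (a - b))\<^sup>2 \<le> 2 * (norm a)\<^sup>2 + 2 * (norm b)\<^sup>2" for a b :: 'a
  proof -
    have "(norm (a - b))\<^sup>2 \<le> (norm a + norm b)\<^sup>2"
      by (intro power_mono norm_triangle_ineq4) auto
    also have "\<dots> \<le> 2 * (norm a)\<^sup>2 + 2 * (norm b)\<^sup>2"
      using zero_le_power2[of "norm a - norm b"] by (simp add: power2_eq_square algebra_simps)
    finally show ?thesis .
  qed
  show ?thesis
    by (rule Bochner_Integration.integrable_bound[OF i]) (use f g bound in \<open>auto intro!: AE_I2\<close>)
qed

(* The usual topology of a metric: the sets containing a d-ball around each of their points.
   The library's Metric_space.mtopology has the same definition, but its defining equations are
   available only under the metric axioms; the two agree by metric_topology_eq_mtopology. *)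
definition metric_topology :: "'a set \<Rightarrow> ('a \<Rightarrow> 'a \<Rightarrow> real) \<Rightarrow> 'a topology" where
  "metric_topology M d =
     topology (\<lambda>U. U \<subseteq> M \<and> (\<forall>x\<in>U. \<exists>r>0. {y\<in>M. d x y < r} \<subseteq> U))"

lemma openin_metric_topology:
  "openin (metric_topology M d) U \<longleftrightarrow> U \<subseteq> M \<and> (\<forall>x\<in>U. \<exists>r>0. {y\<in>M. d x y < r} \<subseteq> U)"
proof -
  define P where "P U \<longleftrightarrow> U \<subseteq> M \<and> (\<forall>x\<in>U. \<exists>r>0. {y\<in>M. d x y < r} \<subseteq> U)" for U
  have inter: "P (S \<inter> T)" if "P S" "P T" for S T
    unfolding P_def
  proof (intro conjI ballI)
    fix x assume "x \<in> S \<inter> T"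
    with that obtain r s where "r > 0" "s > 0"
      "{y\<in>M. d x y < r} \<subseteq> S" "{y\<in>M. d x y < s} \<subseteq> T"
      unfolding P_def by blast
    then show "\<exists>r>0. {y\<in>M. d x y < r} \<subseteq> S \<inter> T"
      by (intro exI[of _ "min r s"]) auto
  qed (use that in \<open>auto simp: P_def\<close>)
  have "P (\<Union>K)" if K: "\<forall>S\<in>K. P S" for K
    unfolding P_def
  proof (intro conjI ballI)
    show "\<Union>K \<subseteq> M" using K by (auto simp: P_def)
    fix x assume "x \<in> \<Union>K"
    then obtain S where S: "S \<in> K" "x \<in> S" by blast
    with K obtain r where "r > 0" "{y\<in>M. d x y < r} \<subseteq> S"
      unfolding P_def by blast
    with S show "\<exists>r>0. {y\<in>M. d x y < r} \<subseteq> \<Union>K" by blast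
  qed
  with inter have "istopology P"
    by (simp add: istopology_def)
  moreover have "metric_topology M d = topology P"
    unfolding metric_topology_def P_def by simp
  ultimately show ?thesis
    by (simp add: P_def)
qed

lemma metric_topology_eq_mtopology:
  assumes "Metric_space M d"
  shows "metric_topology M d = Metric_space.mtopology M d"
proof -
  interpret Metric_space M d by (fact assms)
  show ?thesis
    unfolding topology_eq openin_metric_topology openin_mtopology mball_def by blast
qed

end

theory Submission
  imports Defs
begin

text \<open>
  Each of the three distances is controlled, near a fixed body \<open>C\<close>, by another one.
  If \<open>D\<close> is Hausdorff close to \<open>C\<close>, then \<open>C \<triangle> D\<close> lies in a thin neighbourhood of the
  negligible set \<open>\<partial>C\<close>. If \<open>D\<close> is not Hausdorff close to \<open>C\<close>, then by convexity there is a ball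
  of radius \<open>k\<close> contained in one of the two bodies and \<open>k\<close>-far from the other, with \<open>k\<close> depending
  on \<open>C\<close> only; so \<open>D\<close> is not close in volume, and every transport plan has to move the mass of
  that ball over the distance \<open>k\<close>. Finally, if \<open>D\<close> is close to \<open>C\<close> in volume, then it is bounded
  uniformly, and a transport plan that moves only the mass outside \<open>C \<inter> D\<close> is cheap.
\<close>

section \<open>Convex geometry: balls inside convex sets\<close>

lemma convex_bodiesD:
  fixes C :: "'a::euclidean_space set"
  assumes "C \<in> convex_bodies"
  shows "C \<noteq> {}" "compact C" "closed C" "convex C" "interior C \<noteq> {}"
proof -
  obtain U where U: "open U" "C = closure U" and C: "C \<noteq> {}" "bounded C" "closed C" "convex C"
    using assms by (auto simp: convex_bodies_def)
  show "C \<noteq> {}" "compact C" "closed C" "convex C"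
    using C by (auto simp: compact_eq_bounded_closed)
  show "interior C \<noteq> {}"
    using U C closure_subset[of U] interior_maximal[of U C] by fastforce
qed

text \<open>A point outside \<open>D\<close>, pushed by \<open>e\<close> in the direction away from
  its closest point in \<open>D\<close>, gains the full amount \<open>e\<close> in distance from
  \<open>D\<close> and so ends up farther than \<open>e\<close>. This recovers honest inclusions
  from Hausdorff estimates.\<close>

lemma inner_parallel_subset:
  fixes D :: "'a::euclidean_space set"
  assumes "closed D" "convex D" "D \<noteq> {}" "e \<ge> 0"
    and near: "\<And>z. z \<in> cball x e \<Longrightarrow> infdist z D \<le> e"
  shows "x \<in> D"
proof (rule ccontr)
  assume x: "x \<notin> D"
  define y where "y = closest_point D x"
  define u where "u = (x - y) /\<^sub>R norm (x - y)"
  have yD: "y \<in> D" unfolding y_def using assms by (intro closest_point_in_set)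
  with x have xy: "norm (x - y) > 0" by auto
  then have nu: "norm u = 1" by (simp add: u_def)
  have uu: "u \<bullet> u = 1" using nu by (simp add: norm_eq_1)
  have ux: "u \<bullet> (x - y) = norm (x - y)"
    using xy by (simp add: u_def dot_square_norm power2_eq_square)
  \<comment> \<open>The hyperplane through \<open>y\<close> with normal \<open>u\<close> supports
    \<open>D\<close>; the bound comes from projecting \<open>x + e *\<^sub>R u - w\<close> onto
    \<open>u\<close>.\<close>
  have far: "norm (x - y) + e \<le> dist (x + e *\<^sub>R u) w" if "w \<in> D" for w
  proof -
    have "(x - y) \<bullet> (w - y) \<le> 0"
      unfolding y_def by (rule closest_point_dot) (use assms that in auto)
    then have "u \<bullet> (w - y) \<le> 0"
      using xy by (simp add: u_def mult_nonneg_nonpos)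
    then have "norm (x - y) + e \<le> u \<bullet> (x - y) + e * (u \<bullet> u) - u \<bullet> (w - y)"
      using ux uu by simp
    also have "\<dots> = u \<bullet> (x + e *\<^sub>R u - w)"
      by (simp add: inner_diff_right inner_add_right)
    also have "\<dots> \<le> norm u * norm (x + e *\<^sub>R u - w)" by (rule norm_cauchy_schwarz)
    finally show ?thesis by (simp add: nu dist_norm)
  qed
  have "norm (x - y) + e \<le> infdist (x + e *\<^sub>R u) D"
    using assms far by (auto simp: infdist_def intro!: cINF_greatest)
  moreover have "infdist (x + e *\<^sub>R u) D \<le> e"
    by (rule near) (use nu \<open>e \<ge> 0\<close> in \<open>auto simp: dist_norm\<close>)
  ultimately show False using xy by simp
qed

text \<open>The small ball is the image of \<open>cball c r\<close> under the homothety with centre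
  \<open>y\<close> and ratio \<open>t\<close>, which maps \<open>S\<close> into itself by
  convexity.\<close>

lemma convex_cball_towards:
  fixes S :: "'a::real_normed_vector set"
  assumes "convex S" "cball c r \<subseteq> S" "y \<in> S" "0 < t" "t \<le> 1"
  shows "cball ((1 - t) *\<^sub>R y + t *\<^sub>R c) (t * r) \<subseteq> S"
proof
  fix z assume z: "z \<in> cball ((1 - t) *\<^sub>R y + t *\<^sub>R c) (t * r)"
  define v where "v = z - ((1 - t) *\<^sub>R y + t *\<^sub>R c)"
  have "norm v \<le> t * r" using z by (simp add: v_def dist_norm norm_minus_commute)
  then have "norm (v /\<^sub>R t) \<le> r" using \<open>0 < t\<close> by (simp add: field_simps)
  then have "c + v /\<^sub>R t \<in> S" using assms(2) by (auto simp: dist_norm)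
  then have "(1 - t) *\<^sub>R y + t *\<^sub>R (c + v /\<^sub>R t) \<in> S"
    using assms by (intro convexD) auto
  also have "(1 - t) *\<^sub>R y + t *\<^sub>R (c + v /\<^sub>R t) = z"
    using \<open>0 < t\<close> by (simp add: v_def algebra_simps)
  finally show "z \<in> S" .
qed

text \<open>Shrinking \<open>cball c r\<close> towards \<open>y\<close> keeps it in \<open>S\<close>
  and brings it within \<open>e / 2\<close> of \<open>y\<close>. As \<open>infdist\<close> is
  1-Lipschitz, the shrunken ball stays at distance at least \<open>e / 2\<close> from
  \<open>T\<close>. The radius \<open>k\<close> depends on \<open>e\<close>, \<open>r\<close> and
  \<open>L\<close> only, which makes the estimate uniform in \<open>S\<close> and
  \<open>T\<close>.\<close>

lemma convex_ball_away:
  fixes S :: "'a::real_normed_vector set"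
  assumes "convex S" "cball c r \<subseteq> S" "y \<in> S" "dist y c \<le> L" "0 < e" "e \<le> r" "e \<le> infdist y T"
  defines "k \<equiv> e * r / (2 * (L + r))"
  shows "\<exists>x. ball x k \<subseteq> S \<and> (\<forall>z\<in>ball x k. k \<le> infdist z T)"
proof -
  \<comment> \<open>The ratio is chosen so that \<open>t * L\<close>, which bounds the displacement
    of the centre from \<open>y\<close>, and the radius \<open>t * r\<close> add up to
    \<open>e / 2\<close>.\<close>
  define t where "t = e / (2 * (L + r))"
  define x where "x = (1 - t) *\<^sub>R y + t *\<^sub>R c"
  have L: "L \<ge> 0" using assms(4) zero_le_dist[of y c] by linarith
  have t: "0 < t" "t \<le> 1" "t * (L + r) = e / 2" and k: "k = t * r"
    using assms L by (auto simp: t_def k_def field_simps)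
  have ke: "k \<le> e / 2"
    using t(3) mult_nonneg_nonneg[OF less_imp_le[OF t(1)] L] unfolding k distrib_left by linarith
  have xy: "dist y x \<le> t * L"
  proof -
    have "y - x = t *\<^sub>R (y - c)" by (simp add: x_def algebra_simps)
    then have "dist y x = t * dist y c" using t by (simp add: dist_norm)
    then show ?thesis using assms t by simp
  qed
  have "ball x k \<subseteq> S"
    using convex_cball_towards[OF assms(1-3) t(1,2)] by (force simp: x_def k)
  moreover have "k \<le> infdist z T" if "z \<in> ball x k" for z
  proof -
    have "dist y z \<le> t * L + t * r"
      using xy that dist_triangle[of y z x] by (simp add: k)
    then have "dist y z \<le> e / 2" using t by (simp add: algebra_simps)
    then show ?thesis
      using infdist_triangle[of y T z] assms ke by linarith
  qed
  ultimately show ?thesis by blast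
qed

section \<open>The Hausdorff distance and balls separating two bodies\<close>

lemma hausdorff_distD:
  fixes C D :: "'a::euclidean_space set"
  assumes "compact C" "compact D" "hausdorff_dist C D < e"
  shows "x \<in> C \<Longrightarrow> infdist x D < e" "x \<in> D \<Longrightarrow> infdist x C < e"
proof -
  have b: "bdd_above ((\<lambda>x. infdist x B) ` A)" if "compact A" for A B :: "'a set"
    using that by (intro bounded_imp_bdd_above compact_imp_bounded compact_continuous_image
        continuous_intros)
  show "x \<in> C \<Longrightarrow> infdist x D < e" "x \<in> D \<Longrightarrow> infdist x C < e"
    using assms cSUP_upper[OF _ b, of x C D] cSUP_upper[OF _ b, of x D C]
    by (auto simp: hausdorff_dist_def)
qed

lemma hausdorff_dist_le:
  fixes C D :: "'a::euclidean_space set"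
  assumes "C \<noteq> {}" "D \<noteq> {}" "\<And>x. x \<in> C \<Longrightarrow> infdist x D \<le> e" "\<And>x. x \<in> D \<Longrightarrow> infdist x C \<le> e"
  shows "hausdorff_dist C D \<le> e"
  using assms by (auto simp: hausdorff_dist_def intro!: cSUP_least)

text \<open>This dichotomy serves both the volume and the Wasserstein distance. A point of one body
  that is far from the other one is thickened to a ball by \<open>convex_ball_away\<close>. The
  delicate case is a far point of \<open>D\<close>: an inner ball of \<open>D\<close> and a distance
  bound have to be found that do not depend on \<open>D\<close>.\<close>

lemma hausdorff_dist_less_or_ball_away:
  fixes C :: "'a::euclidean_space set"
  assumes C: "C \<in> convex_bodies" and "0 < \<epsilon>"
  obtains k where "0 < k"
    "\<And>D. D \<in> convex_bodies \<Longrightarrow> hausdorff_dist C D < \<epsilon>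
        \<or> (\<exists>x. ball x k \<subseteq> C \<and> (\<forall>z\<in>ball x k. k \<le> infdist z D))
        \<or> (\<exists>x. ball x k \<subseteq> D \<and> (\<forall>z\<in>ball x k. k \<le> infdist z C))"
proof -
  note Cd = convex_bodiesD[OF C]
  obtain c where c: "c \<in> interior C" using Cd by blast
  then obtain r where r: "r > 0" "cball c r \<subseteq> C"
    using mem_interior_cball by blast
  have cC: "c \<in> C" using r by auto
  obtain R where R: "\<And>x. x \<in> C \<Longrightarrow> dist x c \<le> R"
    using compact_imp_bounded[OF Cd(2)] unfolding bounded_any_center[where a = c]
    by (auto simp: dist_commute)
  have R0: "R \<ge> 0" using R[OF cC] by simp
  \<comment> \<open>The bound \<open>r / 2\<close> ensures that the \<open>e\<close>-neighbourhood
    of \<open>cball c (r / 2)\<close> stays in \<open>C\<close>; the bound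
    \<epsilon>\<open>/ 2\<close> makes the final inequality strict.\<close>
  define e where "e = min (\<epsilon> / 2) (r / 2)"
  have e: "0 < e" "e \<le> r / 2" "e < \<epsilon>" using r \<open>0 < \<epsilon>\<close> by (auto simp: e_def)
  \<comment> \<open>The radius from \<open>convex_ball_away\<close> for inner radius
    \<open>r / 2\<close> and distance bound \<open>R + e\<close>; these two values suit both
    bodies.\<close>
  define k where "k = e * (r / 2) / (2 * ((R + e) + r / 2))"
  show thesis
  proof (rule that[of k])
    show "0 < k" unfolding k_def using e r R0 by (intro divide_pos_pos mult_pos_pos add_nonneg_pos) auto
    fix D :: "'a set" assume D: "D \<in> convex_bodies"
    note Dd = convex_bodiesD[OF D]
    consider (1) y where "y \<in> C" "e \<le> infdist y D"
      | (2) y where "\<And>x. x \<in> C \<Longrightarrow> infdist x D \<le> e" "y \<in> D" "e \<le> infdist y C"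
      | (3) "\<And>x. x \<in> C \<Longrightarrow> infdist x D \<le> e" "\<And>x. x \<in> D \<Longrightarrow> infdist x C \<le> e"
      by (meson linear)
    then show "hausdorff_dist C D < \<epsilon>
        \<or> (\<exists>x. ball x k \<subseteq> C \<and> (\<forall>z\<in>ball x k. k \<le> infdist z D))
        \<or> (\<exists>x. ball x k \<subseteq> D \<and> (\<forall>z\<in>ball x k. k \<le> infdist z C))"
    proof cases
      case 1
      have "cball c (r / 2) \<subseteq> C" using r by auto
      then have "\<exists>x. ball x k \<subseteq> C \<and> (\<forall>z\<in>ball x k. k \<le> infdist z D)"
        unfolding k_def using Cd 1 e R[of y] by (intro convex_ball_away) auto
      then show ?thesis by blast
    next
      case 2
      \<comment> \<open>Each point of this ball has its closed \<open>e\<close>-ball inside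
        \<open>C\<close>, hence within \<open>e\<close> of \<open>D\<close>, so
        \<open>inner_parallel_subset\<close> applies.\<close>
      have sub: "cball c (r / 2) \<subseteq> D"
      proof
        fix x assume x: "x \<in> cball c (r / 2)"
        show "x \<in> D"
        proof (rule inner_parallel_subset[OF Dd(3,4,1)])
          fix z assume "z \<in> cball x e"
          then have "dist c z \<le> r"
            using x e dist_triangle[of c z x] by simp
          then show "infdist z D \<le> e" using r 2 by auto
        qed (use e in auto)
      qed
      then have cD: "c \<in> D" using r by auto
      \<comment> \<open>Moving \<open>y\<close> towards \<open>c\<close> keeps the distance from \<open>c\<close> bounded independently of \<open>D\<close>.\<close>
      have "\<exists>t\<ge>0. t \<le> 1 \<and> infdist ((1 - t) *\<^sub>R c + t *\<^sub>R y) C = e"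
        by (rule IVT') (use 2 e cC in \<open>auto intro!: continuous_intros\<close>)
      then obtain t where t: "0 \<le> t" "t \<le> 1" "infdist ((1 - t) *\<^sub>R c + t *\<^sub>R y) C = e" by blast
      define y' where "y' = (1 - t) *\<^sub>R c + t *\<^sub>R y"
      have y': "y' \<in> D" unfolding y'_def using t Dd cD 2 by (intro convexD) auto
      obtain w where w: "w \<in> C" "infdist y' C = dist y' w"
        using infdist_attains_inf Cd by metis
      have "dist y' c \<le> R + e"
        using dist_triangle[of y' c w] R[OF w(1)] w t by (simp add: y'_def)
      then have "\<exists>x. ball x k \<subseteq> D \<and> (\<forall>z\<in>ball x k. k \<le> infdist z C)"
        unfolding k_def using Dd t e sub y' by (intro convex_ball_away[of D c _ y']) (auto simp: y'_def)
      then show ?thesis by blast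
    next
      case 3
      then show ?thesis using hausdorff_dist_le[OF Cd(1) Dd(1), of e] e by auto
    qed
  qed
qed

section \<open>Hausdorff closeness implies volume closeness\<close>

text \<open>The segment from \<open>a\<close> to \<open>b\<close> is connected and must cross the
  frontier; the crossing point is no farther from either end than the ends are from each
  other.\<close>

lemma infdist_frontier_le_dist:
  fixes C :: "'a::euclidean_space set"
  assumes "a \<in> C" "b \<notin> C"
  shows "infdist a (frontier C) \<le> dist a b" "infdist b (frontier C) \<le> dist a b"
proof -
  have "closed_segment a b \<inter> frontier C \<noteq> {}"
    by (rule connected_Int_frontier) (use assms in auto)
  then obtain z where z: "z \<in> closed_segment a b" "z \<in> frontier C" by blast
  then have "dist a z \<le> dist a b" "dist b z \<le> dist a b"
    using dist_in_closed_segment[OF z(1)] by (auto simp: dist_commute)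
  then show "infdist a (frontier C) \<le> dist a b" "infdist b (frontier C) \<le> dist a b"
    using infdist_le[OF z(2), of a] infdist_le[OF z(2), of b] by auto
qed

text \<open>For \<open>x\<close> in \<open>C - D\<close>, \<open>inner_parallel_subset\<close>
  yields a point within \<open>e\<close> of \<open>x\<close> that is farther than \<open>e\<close>
  from \<open>D\<close> and hence outside \<open>C\<close>. For \<open>x\<close> in
  \<open>D - C\<close>, the nearest point of \<open>C\<close> is closer than \<open>e\<close>. In
  both cases the frontier of \<open>C\<close> is crossed on the way.\<close>

lemma sym_diff_subset_frontier_nbhd:
  fixes C D :: "'a::euclidean_space set"
  assumes C: "C \<in> convex_bodies" and D: "D \<in> convex_bodies" and "hausdorff_dist C D < e"
  shows "sym_diff C D \<subseteq> {x. infdist x (frontier C) \<le> e}"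
proof -
  note Cd = convex_bodiesD[OF C] and Dd = convex_bodiesD[OF D]
  note H = hausdorff_distD[OF Cd(2) Dd(2) assms(3)]
  have "e > 0" using H(1) Cd(1) infdist_nonneg order_le_less_trans by blast
  show ?thesis
  proof (intro subsetI CollectI)
    fix x assume "x \<in> sym_diff C D"
    then consider "x \<in> C" "x \<notin> D" | "x \<in> D" "x \<notin> C" by blast
    then show "infdist x (frontier C) \<le> e"
    proof cases
      case 1
      then obtain z where z: "z \<in> cball x e" "\<not> infdist z D \<le> e"
        using inner_parallel_subset[OF Dd(3,4,1), of e x] \<open>e > 0\<close> by force
      with H(1)[of z] have "z \<notin> C" by auto
      then show ?thesis
        using infdist_frontier_le_dist(1)[OF 1(1)] z by fastforce
    next
      case 2
      obtain w where w: "w \<in> C" "infdist x C = dist x w"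
        using infdist_attains_inf Cd by metis
      then show ?thesis
        using infdist_frontier_le_dist(2)[OF w(1) 2(2)] H(2)[OF 2(1)] by (simp add: dist_commute)
    qed
  qed
qed

text \<open>Continuity of the measure from above: the closed neighbourhoods are compact, hence of
  finite measure, and decrease to the frontier, which is negligible because \<open>C\<close> is
  convex.\<close>

lemma measure_frontier_nbhd_tendsto_0:
  fixes C :: "'a::euclidean_space set"
  assumes C: "C \<in> convex_bodies"
  shows "(\<lambda>n. measure lborel {x. infdist x (frontier C) \<le> 1 / real (Suc n)}) \<longlonglongrightarrow> 0"
proof -
  note Cd = convex_bodiesD[OF C]
  define F where "F n = {x. infdist x (frontier C) \<le> 1 / real (Suc n)}" for n
  have fr: "compact (frontier C)" "frontier C \<noteq> {}"
    using Cd not_bounded_UNIV[where 'a = 'a]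
    by (auto simp: compact_frontier frontier_eq_empty compact_imp_bounded)
  have cF: "compact (F n)" for n
    unfolding F_def by (rule compact_infdist_le) (use fr in auto)
  have "(\<lambda>n. measure lborel (F n)) \<longlonglongrightarrow> measure lborel (\<Inter>n. F n)"
  proof (rule Lim_measure_decseq)
    show "range F \<subseteq> sets lborel" using cF by (auto intro: borel_compact)
    show "decseq F" by (auto simp: F_def decseq_def intro: order_trans simp: frac_le)
    show "emeasure lborel (F i) \<noteq> \<infinity>" for i
      using cF[of i] emeasure_lborel_cbox_finite emeasure_compact_finite by (auto simp: less_top[symmetric])
  qed
  also have "(\<Inter>n. F n) = frontier C"
  proof (intro set_eqI iffI)
    fix x assume x: "x \<in> (\<Inter>n. F n)"
    have "infdist x (frontier C) \<le> 0"
    proof (rule ccontr)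
      assume "\<not> infdist x (frontier C) \<le> 0"
      then obtain n where "1 / real (Suc n) < infdist x (frontier C)"
        using nat_approx_posE by (meson not_le)
      with x show False by (auto simp: F_def not_le[symmetric])
    qed
    then have "infdist x (frontier C) = 0" using infdist_nonneg[of x] by (simp add: antisym)
    then show "x \<in> frontier C"
      using in_closed_iff_infdist_zero[OF _ fr(2)] by (auto simp: frontier_closed)
  qed (auto simp: F_def)
  also have "measure lborel (frontier C) = 0"
  proof -
    \<comment> \<open>Negligibility concerns the completed measure; the frontier is closed, hence
      Borel, so \<open>lborel\<close> gives it the same value.\<close>
    have "frontier C \<in> null_sets lebesgue"
      using negligible_convex_frontier[OF Cd(4)] by (simp add: negligible_iff_null_sets)
    then show ?thesis
      by (simp add: measure_def null_sets_def emeasure_completion frontier_closed borel_closed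
          flip: measure_completion)
  qed
  finally show ?thesis by (simp add: F_def)
qed

text \<open>The neighbourhood of the frontier that contains the symmetric difference depends on
  \<open>C\<close> alone, so its width can be fixed before \<open>D\<close> is given.\<close>

lemma volume_dist_less_if_hausdorff_dist_less:
  fixes C :: "'a::euclidean_space set"
  assumes C: "C \<in> convex_bodies" and "0 < \<epsilon>"
  obtains \<delta> where "0 < \<delta>"
    "\<And>D. D \<in> convex_bodies \<Longrightarrow> hausdorff_dist C D < \<delta> \<Longrightarrow> volume_dist C D < \<epsilon>"
proof -
  note Cd = convex_bodiesD[OF C]
  obtain n where n: "measure lborel {x. infdist x (frontier C) \<le> 1 / real (Suc n)} < \<epsilon>"
    using order_tendstoD(2)[OF measure_frontier_nbhd_tendsto_0[OF C] \<open>0 < \<epsilon>\<close>]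
    by (auto simp: eventually_sequentially)
  have fr: "compact (frontier C)" "frontier C \<noteq> {}"
    using Cd not_bounded_UNIV[where 'a = 'a]
    by (auto simp: compact_frontier frontier_eq_empty compact_imp_bounded)
  have cF: "compact {x. infdist x (frontier C) \<le> 1 / real (Suc n)}"
    by (rule compact_infdist_le) (use fr in auto)
  show thesis
  proof (rule that[of "1 / real (Suc n)"])
    fix D :: "'a set" assume D: "D \<in> convex_bodies" and H: "hausdorff_dist C D < 1 / real (Suc n)"
    have "volume_dist C D \<le> measure lborel {x. infdist x (frontier C) \<le> 1 / real (Suc n)}"
      unfolding volume_dist_def
      using sym_diff_subset_frontier_nbhd[OF C D H] convex_bodiesD(3)[OF D] Cd(3)
        cF emeasure_compact_finite[OF cF]
      by (intro measure_mono_fmeasurable) (auto simp: fmeasurable_def borel_compact)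
    with n show "volume_dist C D < \<epsilon>" by linarith
  qed simp
qed

section \<open>Volumes of convex bodies; volume closeness implies Hausdorff closeness\<close>

lemma fmeasurable_lborel_compact:
  fixes S :: "'a::euclidean_space set"
  shows "compact S \<Longrightarrow> S \<in> fmeasurable lborel"
  using emeasure_compact_finite[of S] by (auto simp: fmeasurable_def borel_compact less_top)

lemma measure_Int_plus_Diff:
  assumes "A \<in> fmeasurable M" "B \<in> sets M"
  shows "measure M A = measure M (A \<inter> B) + measure M (A - B)"
proof -
  have "A \<inter> B \<in> fmeasurable M" "A - B \<in> fmeasurable M"
    using assms by (auto intro: fmeasurableI2)
  then have "measure M ((A \<inter> B) \<union> (A - B)) = measure M (A \<inter> B) + measure M (A - B)"
    by (intro measure_Union) (auto simp: fmeasurable_def)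
  then show ?thesis by (simp add: Int_Diff_Un)
qed

lemma content_convex_body_pos:
  fixes C :: "'a::euclidean_space set"
  assumes "C \<in> convex_bodies"
  shows "0 < measure lborel C"
proof -
  obtain c r where r: "r > 0" "ball c r \<subseteq> C"
    using convex_bodiesD(5)[OF assms] mem_interior by blast
  have "measure lborel (ball c r) \<le> measure lborel C"
    using r fmeasurable_lborel_compact[OF convex_bodiesD(2)[OF assms]]
    by (intro measure_mono_fmeasurable) auto
  then show ?thesis using content_ball_pos[OF r(1), of c] by linarith
qed

lemma uniform_measure_convex_body:
  fixes C :: "'a::euclidean_space set"
  assumes C: "C \<in> convex_bodies"
  shows "prob_space (uniform_measure lborel C)"
    and "B \<in> sets borel \<Longrightarrow>
      measure (uniform_measure lborel C) B = measure lborel (C \<inter> B) / measure lborel C"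
    and "AE x in uniform_measure lborel C. x \<in> C"
    and "integrable (uniform_measure lborel C) (\<lambda>x. (norm x)\<^sup>2)"
proof -
  note Cd = convex_bodiesD[OF C]
  have fin: "emeasure lborel C \<noteq> \<infinity>" "C \<in> sets lborel"
    using fmeasurable_lborel_compact[OF Cd(2)] by (auto simp: fmeasurable_def)
  have pos: "emeasure lborel C \<noteq> 0"
    using content_convex_body_pos[OF C] by (auto simp: measure_def)
  show p: "prob_space (uniform_measure lborel C)"
    using pos fin by (intro prob_space_uniform_measure) auto
  show "B \<in> sets borel \<Longrightarrow>
      measure (uniform_measure lborel C) B = measure lborel (C \<inter> B) / measure lborel C"
    using pos fin by (intro measure_uniform_measure) auto
  show ae: "AE x in uniform_measure lborel C. x \<in> C"
    using fin by (intro AE_uniform_measureI) auto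
  interpret prob_space "uniform_measure lborel C" by (rule p)
  obtain K where K: "\<And>x. x \<in> C \<Longrightarrow> norm x \<le> K"
    using compact_imp_bounded[OF Cd(2)] by (auto simp: bounded_iff)
  have "AE x in uniform_measure lborel C. norm ((norm x)\<^sup>2) \<le> K\<^sup>2"
    using ae by eventually_elim (auto intro!: power_mono K)
  then show "integrable (uniform_measure lborel C) (\<lambda>x. (norm x)\<^sup>2)"
    by (rule integrable_const_bound) auto
qed

text \<open>A ball in one body at positive distance from the other lies in the symmetric difference.
  By translation invariance its volume depends on \<open>k\<close> alone, and this volume serves as
  \<delta>.\<close>

lemma hausdorff_dist_less_if_volume_dist_less:
  fixes C :: "'a::euclidean_space set"
  assumes C: "C \<in> convex_bodies" and "0 < \<epsilon>"
  obtains \<delta> where "0 < \<delta>"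
    "\<And>D. D \<in> convex_bodies \<Longrightarrow> volume_dist C D < \<delta> \<Longrightarrow> hausdorff_dist C D < \<epsilon>"
proof -
  obtain k where k: "0 < k" "\<And>D. D \<in> convex_bodies \<Longrightarrow> hausdorff_dist C D < \<epsilon>
        \<or> (\<exists>x. ball x k \<subseteq> C \<and> (\<forall>z\<in>ball x k. k \<le> infdist z D))
        \<or> (\<exists>x. ball x k \<subseteq> D \<and> (\<forall>z\<in>ball x k. k \<le> infdist z C))"
    using hausdorff_dist_less_or_ball_away[OF assms] by blast
  show thesis
  proof (rule that[of "measure lborel (ball (0::'a) k)"])
    show "0 < measure lborel (ball (0::'a) k)" using k by (intro content_ball_pos)
    fix D :: "'a set" assume D: "D \<in> convex_bodies"
      and V: "volume_dist C D < measure lborel (ball (0::'a) k)"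
    have f: "sym_diff C D \<in> fmeasurable lborel"
      using convex_bodiesD(2)[OF C] convex_bodiesD(2)[OF D] fmeasurable_lborel_compact by blast
    have no: False if "ball x k \<subseteq> sym_diff C D" for x
    proof -
      have "measure lborel (ball x k) \<le> volume_dist C D"
        unfolding volume_dist_def using that f by (intro measure_mono_fmeasurable) auto
      with V k show False by (simp add: content_ball)
    qed
    show "hausdorff_dist C D < \<epsilon>"
      using k(2)[OF D]
    proof (elim disjE exE conjE)
      fix x assume x: "ball x k \<subseteq> C" "\<forall>z\<in>ball x k. k \<le> infdist z D"
      then have "ball x k \<subseteq> sym_diff C D" using k(1) by force
      then show ?thesis using no by blast
    next
      fix x assume x: "ball x k \<subseteq> D" "\<forall>z\<in>ball x k. k \<le> infdist z C"
      then have "ball x k \<subseteq> sym_diff C D" using k(1) by force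
      then show ?thesis using no by blast
    qed
  qed
qed

section \<open>Couplings; Wasserstein closeness implies Hausdorff closeness\<close>

lemma measurable_coupling:
  fixes \<xi> :: "('a::euclidean_space \<times> 'a) measure"
  assumes "sets \<xi> = sets borel"
  shows "fst \<in> measurable \<xi> borel" "snd \<in> measurable \<xi> borel"
  unfolding measurable_cong_sets[OF assms refl]
  by (auto intro!: borel_measurable_continuous_onI continuous_intros)

lemma coupling_swap:
  fixes m m' :: "'a::euclidean_space measure"
  assumes "\<xi> \<in> couplings m m'"
  defines "\<xi>' \<equiv> distr \<xi> borel (\<lambda>z. (snd z, fst z))"
  shows "\<xi>' \<in> couplings m' m"
    and "(LINT z|\<xi>'. (norm (fst z - snd z))\<^sup>2) = (LINT z|\<xi>. (norm (fst z - snd z))\<^sup>2)"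
proof -
  have \<xi>: "prob_space \<xi>" "sets \<xi> = sets borel" "distr \<xi> borel fst = m" "distr \<xi> borel snd = m'"
    using assms by (auto simp: couplings_def)
  note [measurable] = measurable_coupling[OF \<xi>(2)]
  have sw: "(\<lambda>z. (snd z, fst z)) \<in> measurable \<xi> (borel :: ('a \<times> 'a) measure)"
    unfolding borel_prod[symmetric] by measurable
  note b = measurable_coupling[OF refl, where 'a = 'a]
  show "\<xi>' \<in> couplings m' m"
    unfolding couplings_def \<xi>'_def using \<xi> sw b
    by (auto simp: distr_distr o_def intro: prob_space.prob_space_distr)
  show "(LINT z|\<xi>'. (norm (fst z - snd z))\<^sup>2) = (LINT z|\<xi>. (norm (fst z - snd z))\<^sup>2)"
    unfolding \<xi>'_def using sw b by (subst integral_distr) (auto simp: norm_minus_commute)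
qed

text \<open>Swapping the coordinates maps couplings to couplings at equal cost. The estimates below
  treat the two measures asymmetrically, and symmetry provides the other half.\<close>

lemma W2_commute:
  fixes m m' :: "'a::euclidean_space measure"
  shows "W2 m m' = W2 m' m"
proof -
  let ?c = "\<lambda>\<xi>. sqrt (LINT z|\<xi>. (norm (fst z - snd z :: 'a))\<^sup>2)"
  have "?c ` couplings m m' \<subseteq> ?c ` couplings m' m" for m m' :: "'a measure"
  proof
    fix x assume "x \<in> ?c ` couplings m m'"
    then obtain \<xi> where \<xi>: "\<xi> \<in> couplings m m'" "x = ?c \<xi>" by blast
    show "x \<in> ?c ` couplings m' m"
      by (rule image_eqI[OF _ coupling_swap(1)[OF \<xi>(1)]])
        (simp only: \<xi>(2) coupling_swap(2)[OF \<xi>(1)])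
  qed
  then have "?c ` couplings m m' = ?c ` couplings m' m" by blast
  then show ?thesis by (simp add: W2_def)
qed

lemma W2_le:
  assumes "\<xi> \<in> couplings m m'"
  shows "W2 m m' \<le> sqrt (LINT z|\<xi>. (norm (fst z - snd z))\<^sup>2)"
  unfolding W2_def
  by (rule cINF_lower[OF _ assms]) (auto intro!: bdd_belowI2[of _ 0] integral_nonneg_AE)

text \<open>Independent transport shows that couplings exist, so that lower bounds on all costs pass
  to the infimum in \<open>W2\<close>.\<close>

lemma pair_measure_coupling:
  fixes m m' :: "'a::euclidean_space measure"
  assumes "prob_space m" "prob_space m'" and s: "sets m = sets borel" "sets m' = sets borel"
  shows "m \<Otimes>\<^sub>M m' \<in> couplings m m'"
proof -
  interpret m: prob_space m by fact
  interpret m': prob_space m' by fact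
  interpret pair_prob_space m m' ..
  have "distr (m \<Otimes>\<^sub>M m') borel fst = distr (m \<Otimes>\<^sub>M m') m fst"
    by (intro distr_cong) (auto simp: s)
  moreover have "distr (m \<Otimes>\<^sub>M m') borel snd = distr (m \<Otimes>\<^sub>M m') m' snd"
    by (intro distr_cong) (auto simp: s)
  moreover have "distr (m \<Otimes>\<^sub>M m') m' snd = m'"
  proof (rule measure_eqI)
    fix A assume "A \<in> sets (distr (m \<Otimes>\<^sub>M m') m' snd)"
    then have A: "A \<in> sets m'" by simp
    have "snd -` A \<inter> space (m \<Otimes>\<^sub>M m') = space m \<times> A"
      using sets.sets_into_space[OF A] by (auto simp: space_pair_measure)
    then show "emeasure (distr (m \<Otimes>\<^sub>M m') m' snd) A = emeasure m' A"
      using A by (simp add: emeasure_distr m'.emeasure_pair_measure_Times m.emeasure_space_1)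
  qed simp
  moreover have "sets (m \<Otimes>\<^sub>M m') = sets borel"
    unfolding borel_prod[symmetric] by (intro sets_pair_measure_cong s)
  ultimately show ?thesis
    by (simp add: couplings_def prob_space_axioms m'.distr_pair_fst)
qed

text \<open>Almost every target is at distance at least \<open>k\<close> from all of
  \<open>A\<close>, so the integrand is at least \<open>k\<^sup>2\<close> wherever the first
  coordinate lies in \<open>A\<close>; this event has probability
  \<open>measure m A\<close>.\<close>

lemma coupling_cost_ge:
  fixes m m' :: "'a::euclidean_space measure"
  assumes \<xi>: "\<xi> \<in> couplings m m'"
    and "integrable m (\<lambda>x. (norm x)\<^sup>2)" "integrable m' (\<lambda>x. (norm x)\<^sup>2)"
    and A: "A \<in> sets borel" and "0 \<le> k" and far: "AE y in m'. \<forall>x\<in>A. k \<le> dist x y"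
  shows "k\<^sup>2 * measure m A \<le> (LINT z|\<xi>. (norm (fst z - snd z))\<^sup>2)"
proof -
  have c: "prob_space \<xi>" "sets \<xi> = sets borel" "m = distr \<xi> borel fst" "m' = distr \<xi> borel snd"
    using \<xi> by (auto simp: couplings_def)
  interpret prob_space \<xi> by (rule c)
  note ms[measurable] = measurable_coupling[OF c(2)]
  let ?A = "fst -` A \<inter> space \<xi>"
  have [measurable]: "?A \<in> sets \<xi>" using A by measurable
  have ae: "AE z in \<xi>. \<forall>x\<in>A. k \<le> dist x (snd z)"
    using far unfolding c(4) by (rule AE_distrD[OF ms(2)])
  have "k\<^sup>2 * measure m A = (LINT z|\<xi>. k\<^sup>2 * indicator ?A z)"
    using A by (simp add: c(3) measure_distr)
  also have "\<dots> \<le> (LINT z|\<xi>. (norm (fst z - snd z))\<^sup>2)"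
  proof (rule integral_mono_AE)
    show "integrable \<xi> (\<lambda>z. k\<^sup>2 * indicator ?A z)" by (auto simp: emeasure_eq_measure)
    show "integrable \<xi> (\<lambda>z. (norm (fst z - snd z))\<^sup>2)"
      by (rule integrable_coupling_cost) fact+
    show "AE z in \<xi>. k\<^sup>2 * indicator ?A z \<le> (norm (fst z - snd z))\<^sup>2"
      using ae by eventually_elim
        (use \<open>0 \<le> k\<close> in \<open>auto simp: dist_norm indicator_def intro!: power_mono\<close>)
  qed
  finally show ?thesis .
qed

lemma W2_ge:
  fixes m m' :: "'a::euclidean_space measure"
  assumes "prob_space m" "prob_space m'" "sets m = sets borel" "sets m' = sets borel"
    and "integrable m (\<lambda>x. (norm x)\<^sup>2)" "integrable m' (\<lambda>x. (norm x)\<^sup>2)"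
    and "A \<in> sets borel" "0 \<le> k" "AE y in m'. \<forall>x\<in>A. k \<le> dist x y"
  shows "k * sqrt (measure m A) \<le> W2 m m'"
  unfolding W2_def
proof (rule cINF_greatest)
  show "couplings m m' \<noteq> {}" using pair_measure_coupling assms by blast
  fix \<xi> assume "\<xi> \<in> couplings m m'"
  then have "k\<^sup>2 * measure m A \<le> (LINT z|\<xi>. (norm (fst z - snd z))\<^sup>2)"
    using assms by (intro coupling_cost_ge)
  then have "sqrt (k\<^sup>2 * measure m A) \<le> sqrt (LINT z|\<xi>. (norm (fst z - snd z))\<^sup>2)"
    by (rule real_sqrt_le_mono)
  then show "k * sqrt (measure m A) \<le> sqrt (LINT z|\<xi>. (norm (fst z - snd z))\<^sup>2)"
    using \<open>0 \<le> k\<close> by (simp add: real_sqrt_mult)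
qed

lemma wasserstein_dist_commute: "wasserstein_dist C D = wasserstein_dist D C"
  by (simp add: wasserstein_dist_def W2_commute)

lemma wasserstein_dist_ge:
  fixes C D :: "'a::euclidean_space set"
  assumes C: "C \<in> convex_bodies" and D: "D \<in> convex_bodies"
    and A: "A \<in> sets borel" and "0 \<le> k" and far: "\<And>x. x \<in> A \<Longrightarrow> k \<le> infdist x D"
  shows "k * sqrt (measure lborel (C \<inter> A) / measure lborel C) \<le> wasserstein_dist C D"
proof -
  note uC = uniform_measure_convex_body[OF C] and uD = uniform_measure_convex_body[OF D]
  have "AE y in uniform_measure lborel D. \<forall>x\<in>A. k \<le> dist x y"
    using uD(3)
  proof eventually_elim
    case (elim y)
    then show ?case using far infdist_le[of y D] order_trans by blast
  qed
  then have "k * sqrt (measure (uniform_measure lborel C) A) \<le> wasserstein_dist C D"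
    unfolding wasserstein_dist_def using uC uD A \<open>0 \<le> k\<close> by (intro W2_ge) auto
  then show ?thesis using uC(2)[OF A] by simp
qed

text \<open>Mass in a far ball is expensive to transport, but the share of \<open>D\<close> that a
  ball of radius \<open>k\<close> carries is bounded below only once the volume of \<open>D\<close>
  is bounded above. That bound comes first: a cheap plan leaves less than half of the mass of
  \<open>D\<close> outside the 1-neighbourhood \<open>N\<close> of \<open>C\<close>.\<close>

lemma hausdorff_dist_less_if_wasserstein_dist_less:
  fixes C :: "'a::euclidean_space set"
  assumes C: "C \<in> convex_bodies" and "0 < \<epsilon>"
  obtains \<delta> where "0 < \<delta>"
    "\<And>D. D \<in> convex_bodies \<Longrightarrow> wasserstein_dist C D < \<delta> \<Longrightarrow> hausdorff_dist C D < \<epsilon>"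
proof -
  note Cd = convex_bodiesD[OF C]
  obtain k where k: "0 < k" "\<And>D. D \<in> convex_bodies \<Longrightarrow> hausdorff_dist C D < \<epsilon>
        \<or> (\<exists>x. ball x k \<subseteq> C \<and> (\<forall>z\<in>ball x k. k \<le> infdist z D))
        \<or> (\<exists>x. ball x k \<subseteq> D \<and> (\<forall>z\<in>ball x k. k \<le> infdist z C))"
    using hausdorff_dist_less_or_ball_away[OF assms] by blast
  define N where "N = {x. infdist x C \<le> 1}"
  define v where "v = measure lborel N"
  define b where "b = measure lborel (ball (0::'a) k)"
  have b: "0 < b" unfolding b_def using k by (intro content_ball_pos)
  have N: "N \<in> fmeasurable lborel" "N \<in> sets borel"
    unfolding N_def using Cd
    by (auto intro!: fmeasurable_lborel_compact borel_compact compact_infdist_le)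
  have Cv: "measure lborel C \<le> v"
    unfolding v_def using N Cd by (intro measure_mono_fmeasurable) (auto simp: N_def)
  then have v: "0 < v" using content_convex_body_pos[OF C] by linarith
  \<comment> \<open>The first entry forces \<open>measure lborel D\<close> to be at most
    \<open>2 * v\<close>; the second is the least cost of moving a ball of volume \<open>b\<close>
    over the distance \<open>k\<close> out of a body of volume at most \<open>2 * v\<close>.\<close>
  define \<delta> where "\<delta> = min (sqrt (1/2)) (k * sqrt (b / (2 * v)))"
  show thesis
  proof (rule that[of \<delta>])
    show "0 < \<delta>" using k b v by (simp add: \<delta>_def)
    fix D :: "'a set" assume D: "D \<in> convex_bodies" and W: "wasserstein_dist C D < \<delta>"
    note Dd = convex_bodiesD[OF D]
    define d where "d = measure lborel D"
    have d: "0 < d" unfolding d_def by (rule content_convex_body_pos[OF D])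
    have fD: "D \<in> fmeasurable lborel" using Dd fmeasurable_lborel_compact by blast
    \<comment> \<open>Points outside \<open>N\<close> are farther than 1 from \<open>C\<close>, so
      the lower bound applies with distance 1.\<close>
    have "1 * sqrt (measure lborel (D \<inter> - N) / d) \<le> wasserstein_dist D C"
      unfolding d_def by (rule wasserstein_dist_ge[OF D C]) (use N in \<open>auto simp: N_def\<close>)
    also have "\<dots> < sqrt (1/2)" using W by (simp add: \<delta>_def wasserstein_dist_commute)
    finally have "measure lborel (D \<inter> - N) / d < 1/2" by simp
    then have "measure lborel (D - N) < d / 2" using d by (simp add: field_simps Diff_eq)
    moreover have "measure lborel (D \<inter> N) \<le> v"
      unfolding v_def using N fD by (intro measure_mono_fmeasurable) auto
    moreover have "d = measure lborel (D \<inter> N) + measure lborel (D - N)"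
      unfolding d_def by (rule measure_Int_plus_Diff[OF fD N(2)[folded sets_lborel]])
    ultimately have dv: "d \<le> 2 * v" by linarith
    \<comment> \<open>Stated for a generic ordered pair, since the far ball may lie in
      \<open>C\<close> or in \<open>D\<close>; both have volume at most
      \<open>2 * v\<close>.\<close>
    have no: False if S: "S \<in> convex_bodies" and T: "T \<in> convex_bodies"
      and x: "ball x k \<subseteq> S" "\<forall>z\<in>ball x k. k \<le> infdist z T"
      and W: "wasserstein_dist S T < \<delta>" and S2: "measure lborel S \<le> 2 * v" for S T :: "'a set" and x
    proof -
      have "k * sqrt (measure lborel (S \<inter> ball x k) / measure lborel S) \<le> wasserstein_dist S T"
        by (rule wasserstein_dist_ge) (use S T x k in auto)
      also have "S \<inter> ball x k = ball x k" using x by blast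
      also have "measure lborel (ball x k) = b" using k by (simp add: b_def content_ball)
      finally have "k * sqrt (b / measure lborel S) < k * sqrt (b / (2 * v))"
        using W by (simp add: \<delta>_def)
      then have "b / measure lborel S < b / (2 * v)" using k by simp
      moreover have "b / (2 * v) \<le> b / measure lborel S"
        using S2 b content_convex_body_pos[OF S] by (intro divide_left_mono) auto
      ultimately show False by linarith
    qed
    have "wasserstein_dist D C < \<delta>" "measure lborel C \<le> 2 * v" "measure lborel D \<le> 2 * v"
      using W Cv v dv by (simp_all add: d_def wasserstein_dist_commute)
    then show "hausdorff_dist C D < \<epsilon>"
      using k(2)[OF D] no[OF C D] no[OF D C] W by meson
  qed
qed

section \<open>Cheap transport plans; volume closeness implies Wasserstein closeness\<close>

text \<open>The plan keeps a point of \<open>E\<close> in place and sends any other point to an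
  independent sample of \<open>r\<close>. The assumption \<open>decomp\<close> says exactly that the
  second marginal is then \<open>m'\<close>.\<close>

lemma coupling_replace_off:
  fixes m m' r :: "'a::euclidean_space measure"
  assumes "prob_space m" "prob_space m'" "prob_space r"
    and s: "sets m = sets borel" "sets m' = sets borel" "sets r = sets borel"
    and E: "E \<in> sets borel"
    and decomp: "\<And>B. B \<in> sets borel \<Longrightarrow>
      measure m' B = measure m (E \<inter> B) + measure m (- E) * measure r B"
  defines "\<xi> \<equiv> distr (m \<Otimes>\<^sub>M r) borel (\<lambda>(x, y). (x, if x \<in> E then x else y))"
  shows "\<xi> \<in> couplings m m'" and "measure \<xi> {z. fst z \<noteq> snd z} \<le> measure m (- E)"
proof -
  interpret m: prob_space m by fact
  interpret m': prob_space m' by fact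
  interpret r: prob_space r by fact
  interpret pair_prob_space m r ..
  define g where "g = (\<lambda>(x, y). (x, if x \<in> E then x else y :: 'a))"
  note [measurable_cong] = s
  note [measurable] = E
  have sp: "space m = UNIV" "space r = UNIV" "space m' = UNIV"
    using s by (auto dest!: sets_eq_imp_space_eq)
  have g[measurable]: "g \<in> measurable (m \<Otimes>\<^sub>M r) (borel :: ('a \<times> 'a) measure)"
    unfolding g_def borel_prod[symmetric] by measurable
  have \<xi>: "\<xi> = distr (m \<Otimes>\<^sub>M r) borel g" by (simp add: \<xi>_def g_def)
  note b = measurable_coupling[OF refl, where 'a = 'a]
  have "distr \<xi> borel fst = distr (m \<Otimes>\<^sub>M r) m fst"
    unfolding \<xi> using g b by (subst distr_distr) (auto intro!: distr_cong simp: s g_def)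
  then have 1: "distr \<xi> borel fst = m" by (simp add: r.distr_pair_fst)
  have 2: "distr \<xi> borel snd = m'"
  proof (rule measure_eqI)
    fix B assume "B \<in> sets (distr \<xi> borel snd)"
    then have B[measurable]: "B \<in> sets borel" by simp
    \<comment> \<open>A disjoint union of two rectangles, whose product measures are the two
      summands in \<open>decomp\<close>.\<close>
    have pre: "(\<lambda>z. snd (g z)) -` B \<inter> space (m \<Otimes>\<^sub>M r) = (E \<inter> B) \<times> UNIV \<union> (- E) \<times> B"
      by (auto simp: g_def space_pair_measure sp split: if_splits)
    have mt: "emeasure (m \<Otimes>\<^sub>M r) (A \<times> A') = ennreal (measure m A * measure r A')"
      if "A \<in> sets borel" "A' \<in> sets borel" for A A'
      using that by (subst r.emeasure_pair_measure_Times)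
        (auto simp: m.emeasure_eq_measure r.emeasure_eq_measure ennreal_mult s)
    have ru: "measure r UNIV = 1" using r.prob_space sp by simp
    have "emeasure (distr \<xi> borel snd) B = emeasure (distr (m \<Otimes>\<^sub>M r) borel (\<lambda>z. snd (g z))) B"
      unfolding \<xi> using g b by (subst distr_distr) (auto simp: o_def)
    also have "\<dots> = emeasure (m \<Otimes>\<^sub>M r) ((E \<inter> B) \<times> UNIV \<union> (- E) \<times> B)"
      unfolding pre[symmetric] using measurable_compose[OF g b(2)] by (subst emeasure_distr) auto
    also have "\<dots> = emeasure (m \<Otimes>\<^sub>M r) ((E \<inter> B) \<times> UNIV) + emeasure (m \<Otimes>\<^sub>M r) ((- E) \<times> B)"
      by (rule plus_emeasure[symmetric]) auto
    also have "\<dots> = ennreal (measure m' B)"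
      using decomp[OF B] by (simp add: mt ru flip: ennreal_plus)
    finally show "emeasure (distr \<xi> borel snd) B = emeasure m' B"
      by (simp add: m'.emeasure_eq_measure)
  qed (simp add: s)
  show "\<xi> \<in> couplings m m'"
    using 1 2 prob_space_distr[OF g] by (simp add: couplings_def \<xi>)
  have "measure \<xi> {z. fst z \<noteq> snd z} = measure (m \<Otimes>\<^sub>M r) (g -` {z. fst z \<noteq> snd z})"
    unfolding \<xi>
    by (subst measure_distr) (auto simp: space_pair_measure sp
        intro!: borel_open open_Collect_neq continuous_intros)
  \<comment> \<open>Only an inequality, because the sample of \<open>r\<close> may coincide with the
    starting point.\<close>
  also have "\<dots> \<le> measure (m \<Otimes>\<^sub>M r) ((- E) \<times> UNIV)"
    by (rule finite_measure_mono) (auto simp: g_def split: if_splits)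
  also have "\<dots> = measure m (- E)"
    using r.emeasure_space_1
    by (simp add: measure_def r.emeasure_pair_measure_Times enn2real_mult sp)
  finally show "measure \<xi> {z. fst z \<noteq> snd z} \<le> measure m (- E)" .
qed

text \<open>The cost vanishes on the diagonal and is almost surely at most \<open>L\<^sup>2\<close>
  off it, because both marginals are concentrated on \<open>S\<close>.\<close>

lemma W2_le_diameter:
  fixes m m' :: "'a::euclidean_space measure"
  assumes \<xi>: "\<xi> \<in> couplings m m'" and "AE x in m. x \<in> S" "AE x in m'. x \<in> S"
    and "0 \<le> L" and L: "\<And>x y. x \<in> S \<Longrightarrow> y \<in> S \<Longrightarrow> dist x y \<le> L"
  shows "W2 m m' \<le> L * sqrt (measure \<xi> {z. fst z \<noteq> snd z})"
proof -
  have c: "prob_space \<xi>" "sets \<xi> = sets borel" "m = distr \<xi> borel fst" "m' = distr \<xi> borel snd"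
    using \<xi> by (auto simp: couplings_def)
  interpret prob_space \<xi> by (rule c)
  note ms = measurable_coupling[OF c(2)]
  let ?N = "{z. fst z \<noteq> (snd z :: 'a)}"
  have N: "?N \<in> sets \<xi>"
    unfolding c(2) by (intro borel_open open_Collect_neq continuous_intros)
  have ae: "AE z in \<xi>. fst z \<in> S" "AE z in \<xi>. snd z \<in> S"
    using assms(2,3) unfolding c by (auto dest: AE_distrD[OF ms(1)] AE_distrD[OF ms(2)])
  have "(LINT z|\<xi>. (norm (fst z - snd z))\<^sup>2) \<le> (LINT z|\<xi>. L\<^sup>2 * indicator ?N z)"
  proof (rule integral_mono_AE')
    show "integrable \<xi> (\<lambda>z. L\<^sup>2 * indicator ?N z :: real)"
      using N by (auto simp: emeasure_eq_measure)
    show "AE z in \<xi>. (norm (fst z - snd z))\<^sup>2 \<le> L\<^sup>2 * indicator ?N z"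
      using ae
    proof eventually_elim
      case (elim z)
      then have "(norm (fst z - snd z))\<^sup>2 \<le> L\<^sup>2"
        using L by (intro power_mono) (auto simp: dist_norm)
      then show ?case by (auto simp: indicator_def)
    qed
  qed (auto simp: indicator_def)
  also have "\<dots> = L\<^sup>2 * measure \<xi> ?N"
    using N by (simp add: sets_eq_imp_space_eq[OF c(2)])
  finally have "sqrt (LINT z|\<xi>. (norm (fst z - snd z))\<^sup>2) \<le> sqrt (L\<^sup>2 * measure \<xi> ?N)"
    by (rule real_sqrt_le_mono)
  then show ?thesis
    using W2_le[OF \<xi>] \<open>0 \<le> L\<close> by (simp add: real_sqrt_mult)
qed

text \<open>The normalized residual \<open>m\<^sub>D - m\<^sub>C|\<^bsub>C \<inter> D\<^esub>\<close>; it is nonnegative because the density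
  of \<open>m\<^sub>D\<close> is the larger one.\<close>

lemma uniform_measure_residual:
  fixes C D :: "'a::euclidean_space set"
  assumes C: "C \<in> convex_bodies" and D: "D \<in> convex_bodies"
    and le: "measure lborel D \<le> measure lborel C"
  obtains r where "prob_space r" "sets r = sets borel"
    "\<And>B. B \<in> sets borel \<Longrightarrow> measure (uniform_measure lborel D) B
      = measure (uniform_measure lborel C) (C \<inter> D \<inter> B)
        + measure (uniform_measure lborel C) (- (C \<inter> D)) * measure r B"
proof -
  define a b e where "a = measure lborel C" and "b = measure lborel D"
    and "e = measure lborel (C \<inter> D)"
  note uC = uniform_measure_convex_body[OF C] and uD = uniform_measure_convex_body[OF D]
  have fC: "C \<in> fmeasurable lborel" and fD: "D \<in> fmeasurable lborel"
    using C D convex_bodiesD(2) fmeasurable_lborel_compact by auto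
  have pos: "0 < b" "b \<le> a" using le content_convex_body_pos[OF D] by (auto simp: a_def b_def)
  have sC[measurable]: "C \<in> sets borel" and sD[measurable]: "D \<in> sets borel"
    using fC fD by (auto simp: fmeasurable_def)
  have mE: "measure (uniform_measure lborel C) (C \<inter> D \<inter> B) = measure lborel (C \<inter> D \<inter> B) / a"
    if "B \<in> sets borel" for B
    using that by (subst uC(2)) (auto simp: a_def Int_assoc intro: arg_cong2[where f = measure])
  have ae: "a = e + measure lborel (C - D)" "b = e + measure lborel (D - C)"
    using measure_Int_plus_Diff[OF fC, of D] measure_Int_plus_Diff[OF fD, of C]
    by (auto simp: a_def b_def e_def Int_commute)
  have mN: "measure (uniform_measure lborel C) (- (C \<inter> D)) = (a - e) / a"
  proof -
    have "C \<inter> - (C \<inter> D) = C - D" by blast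
    then show ?thesis using ae by (subst uC(2)) (auto simp: a_def)
  qed
  show thesis
  proof (cases "e = a")
    \<comment> \<open>Here \<open>C\<close> lies in \<open>D\<close> up to a null set and the
      volumes agree. The residual has mass 0 and cannot be normalized; its coefficient is 0, so any
      probability measure will do, and the one of \<open>D\<close> is taken.\<close>
    case True
    then have "measure lborel (D - C) = 0" "a = b"
      using ae pos measure_nonneg[of lborel "D - C"] by linarith+
    show thesis
    proof (rule that[OF uD(1)])
      fix B :: "'a set" assume B: "B \<in> sets borel"
      have fDB: "D \<inter> B \<in> fmeasurable lborel" using fmeasurable_Int_fmeasurable[OF fD, of B] B by simp
      have "measure lborel (D \<inter> B - C) \<le> measure lborel (D - C)"
        using fD sC B by (intro measure_mono_fmeasurable) (auto intro: fmeasurable_Diff)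
      then have "measure lborel (D \<inter> B - C) = 0"
        using \<open>measure lborel (D - C) = 0\<close> measure_nonneg[of lborel "D \<inter> B - C"] by linarith
      then have "measure lborel (D \<inter> B) = measure lborel (C \<inter> D \<inter> B)"
        using measure_Int_plus_Diff[OF fDB, of C] by (simp add: Int_ac)
      then show "measure (uniform_measure lborel D) B
          = measure (uniform_measure lborel C) (C \<inter> D \<inter> B)
            + measure (uniform_measure lborel C) (- (C \<inter> D)) * measure (uniform_measure lborel D) B"
        using True \<open>a = b\<close> mN mE[OF B] uD(2)[OF B] by (simp add: b_def)
    qed simp
  next
    case False
    then have ea: "e < a" using ae measure_nonneg[of lborel "C - D"] by linarith
    \<comment> \<open>The difference of the two densities, divided by its total mass
      \<open>1 - e / a\<close>.\<close>
    define f where "f = (\<lambda>x::'a. (indicator D x / b - indicator (C \<inter> D) x / a) / ((a - e) / a))"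
    define r where "r = density lborel (\<lambda>x. ennreal (f x))"
    have f0: "0 \<le> f x" for x
      using pos ea by (auto simp: f_def indicator_def frac_le intro!: divide_nonneg_nonneg)
    have fm: "f \<in> borel_measurable borel"
      unfolding f_def by measurable
    have er: "emeasure r B
        = ennreal ((measure lborel (D \<inter> B) / b - measure lborel (C \<inter> D \<inter> B) / a) / ((a - e) / a))"
      if B: "B \<in> sets borel" for B
    proof -
      have i: "D \<inter> B \<in> fmeasurable lborel" "C \<inter> D \<inter> B \<in> fmeasurable lborel"
        using fD fC sD B fmeasurable_Int_fmeasurable[of D lborel B]
          fmeasurable_Int_fmeasurable[of C lborel "D \<inter> B"] by (auto simp: Int_assoc)
      have eq: "f x * indicator B x
          = (indicator (D \<inter> B) x / b - indicator (C \<inter> D \<inter> B) x / a) / ((a - e) / a)" for x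
        by (auto simp: f_def indicator_def)
      have int: "integrable lborel (\<lambda>x. f x * indicator B x)"
        unfolding eq using i
        by (intro integrable_divide integrable_diff) (auto simp: fmeasurable_def)
      have "emeasure r B = (\<integral>\<^sup>+x. ennreal (f x) * indicator B x \<partial>lborel)"
        unfolding r_def using fm B by (subst emeasure_density) auto
      also have "\<dots> = (\<integral>\<^sup>+x. ennreal (f x * indicator B x) \<partial>lborel)"
        by (intro nn_integral_cong) (auto simp: indicator_def)
      also have "\<dots> = ennreal (LINT x|lborel. f x * indicator B x)"
        using f0 int by (intro nn_integral_eq_integral) auto
      also have "(LINT x|lborel. f x * indicator B x)
          = (measure lborel (D \<inter> B) / b - measure lborel (C \<inter> D \<inter> B) / a) / ((a - e) / a)"
      proof -
        have "integrable lborel (\<lambda>x. indicat_real (D \<inter> B) x / b)"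
          "integrable lborel (\<lambda>x. indicat_real (C \<inter> D \<inter> B) x / a)"
          using i by (auto simp: fmeasurable_def intro!: integrable_divide)
        then show ?thesis
          unfolding eq integral_divide_zero by (subst Bochner_Integration.integral_diff) auto
      qed
      finally show ?thesis .
    qed
    have pr: "prob_space r"
    proof
      have "emeasure r UNIV = ennreal ((b / b - e / a) / ((a - e) / a))"
        using er[of UNIV] by (simp add: b_def e_def)
      also have "(b / b - e / a) / ((a - e) / a) = 1" using pos ea by (simp add: field_simps)
      finally show "emeasure r (space r) = 1" by (simp add: r_def)
    qed
    show thesis
    proof (rule that[OF pr])
      show "sets r = sets borel" by (simp add: r_def)
      fix B :: "'a set" assume B: "B \<in> sets borel"
      have "measure lborel (C \<inter> D \<inter> B) / a \<le> measure lborel (D \<inter> B) / b"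
        using fD B sC pos by (intro frac_le measure_mono_fmeasurable) (auto intro: fmeasurable_Int_fmeasurable)
      then have "measure r B
          = (measure lborel (D \<inter> B) / b - measure lborel (C \<inter> D \<inter> B) / a) / ((a - e) / a)"
        unfolding measure_def[of r] er[OF B] using pos ea by (intro enn2real_ennreal) auto
      then show "measure (uniform_measure lborel D) B
          = measure (uniform_measure lborel C) (C \<inter> D \<inter> B)
            + measure (uniform_measure lborel C) (- (C \<inter> D)) * measure r B"
        using pos ea mN mE[OF B] uD(2)[OF B] by (simp add: b_def)
    qed
  qed
qed

text \<open>Mass on \<open>C\<close> \<inter> \<open>D\<close> stays in place, and the rest, the
  share of \<open>C - D\<close> in \<open>C\<close>, travels at most \<open>L\<close>. The larger
  body comes first so that the residual measure is nonnegative.\<close>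

lemma wasserstein_dist_le:
  fixes C D :: "'a::euclidean_space set"
  assumes C: "C \<in> convex_bodies" and D: "D \<in> convex_bodies"
    and "measure lborel D \<le> measure lborel C" and "0 \<le> L"
    and L: "\<And>x y. x \<in> C \<union> D \<Longrightarrow> y \<in> C \<union> D \<Longrightarrow> dist x y \<le> L"
  shows "wasserstein_dist C D \<le> L * sqrt (measure lborel (C - D) / measure lborel C)"
proof -
  note uC = uniform_measure_convex_body[OF C] and uD = uniform_measure_convex_body[OF D]
  obtain r where r: "prob_space r" "sets r = sets borel"
    "\<And>B. B \<in> sets borel \<Longrightarrow> measure (uniform_measure lborel D) B
      = measure (uniform_measure lborel C) (C \<inter> D \<inter> B)
        + measure (uniform_measure lborel C) (- (C \<inter> D)) * measure r B"
    using uniform_measure_residual[OF assms(1-3)] by blast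
  have sE: "C \<inter> D \<in> sets borel" 
    by (intro borel_closed closed_Int convex_bodiesD(3)[OF C] convex_bodiesD(3)[OF D])
  define \<xi> where "\<xi> = distr (uniform_measure lborel C \<Otimes>\<^sub>M r) borel
    (\<lambda>(x, y). (x, if x \<in> C \<inter> D then x else y))"
  have \<xi>: "\<xi> \<in> couplings (uniform_measure lborel C) (uniform_measure lborel D)"
    "measure \<xi> {z. fst z \<noteq> snd z} \<le> measure (uniform_measure lborel C) (- (C \<inter> D))"
    using coupling_replace_off[OF uC(1) uD(1) r(1) _ _ r(2) sE r(3)] by (simp_all add: \<xi>_def)
  have "C \<inter> - (C \<inter> D) = C - D" by blast
  then have mN: "measure (uniform_measure lborel C) (- (C \<inter> D))
      = measure lborel (C - D) / measure lborel C"
    using uC(2)[OF borel_comp[OF sE]] by (simp only:)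
  have "AE x in uniform_measure lborel C. x \<in> C \<union> D"
    using uC(3) by eventually_elim auto
  moreover have "AE x in uniform_measure lborel D. x \<in> C \<union> D"
    using uD(3) by eventually_elim auto
  ultimately have "wasserstein_dist C D \<le> L * sqrt (measure \<xi> {z. fst z \<noteq> snd z})"
    unfolding wasserstein_dist_def using \<open>0 \<le> L\<close> L by (rule W2_le_diameter[OF \<xi>(1)])
  also have "\<dots> \<le> L * sqrt (measure lborel (C - D) / measure lborel C)"
    using \<xi>(2) \<open>0 \<le> L\<close> unfolding mN by (intro mult_left_mono real_sqrt_le_mono)
  finally show ?thesis .
qed

text \<open>Volume closeness gives Hausdorff closeness and thereby a diameter bound \<open>L\<close>
  uniform in \<open>D\<close>; the moved share of mass is small because both volumes stay at least
  \<open>a / 2\<close>.\<close>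

lemma wasserstein_dist_less_if_volume_dist_less:
  fixes C :: "'a::euclidean_space set"
  assumes C: "C \<in> convex_bodies" and "0 < \<epsilon>"
  obtains \<delta> where "0 < \<delta>"
    "\<And>D. D \<in> convex_bodies \<Longrightarrow> volume_dist C D < \<delta> \<Longrightarrow> wasserstein_dist C D < \<epsilon>"
proof -
  note Cd = convex_bodiesD[OF C]
  obtain \<delta>1 where \<delta>1: "0 < \<delta>1"
    "\<And>D. D \<in> convex_bodies \<Longrightarrow> volume_dist C D < \<delta>1 \<Longrightarrow> hausdorff_dist C D < 1"
    using hausdorff_dist_less_if_volume_dist_less[OF C, of 1] by auto
  obtain R where R: "\<And>x. x \<in> C \<Longrightarrow> norm x \<le> R"
    using compact_imp_bounded[OF Cd(2)] by (auto simp: bounded_iff)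
  have R0: "0 \<le> R" using R Cd(1) norm_ge_zero order_trans by blast
  define L where "L = 2 * (R + 1)"
  define a where "a = measure lborel C"
  have L: "0 < L" using R0 by (simp add: L_def)
  have a: "0 < a" unfolding a_def by (rule content_convex_body_pos[OF C])
  \<comment> \<open>The entries give in turn Hausdorff distance below 1, volume of \<open>D\<close>
    at least \<open>a / 2\<close>, and transport cost below \<epsilon>.\<close>
  define \<delta> where "\<delta> = min \<delta>1 (min (a / 2) (a / 2 * (\<epsilon> / L)\<^sup>2))"
  show thesis
  proof (rule that[of \<delta>])
    show "0 < \<delta>" using \<delta>1 a L \<open>0 < \<epsilon>\<close> by (simp add: \<delta>_def)
    fix D :: "'a set" assume D: "D \<in> convex_bodies" and V: "volume_dist C D < \<delta>"
    note Dd = convex_bodiesD[OF D]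
    have H: "hausdorff_dist C D < 1" using \<delta>1(2)[OF D] V by (simp add: \<delta>_def)
    have nb: "norm x \<le> R + 1" if "x \<in> C \<union> D" for x
    proof (cases "x \<in> C")
      case False
      then have "infdist x C < 1" using that hausdorff_distD(2)[OF Cd(2) Dd(2) H] by auto
      moreover obtain w where w: "w \<in> C" "infdist x C = dist x w"
        using infdist_attains_inf Cd by metis
      ultimately show ?thesis
        using norm_triangle_sub[of x w] R[OF w(1)] by (simp add: dist_norm)
    qed (use R in force)
    have LL: "dist x y \<le> L" if "x \<in> C \<union> D" "y \<in> C \<union> D" for x y
      using nb[OF that(1)] nb[OF that(2)] norm_triangle_ineq4[of x y] by (simp add: L_def dist_norm)
    have f: "C \<in> fmeasurable lborel" "D \<in> fmeasurable lborel"
      using Cd Dd fmeasurable_lborel_compact by auto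
    then have s: "C \<in> sets lborel" "D \<in> sets lborel" by auto
    have v: "measure lborel (C - D) \<le> volume_dist C D" "measure lborel (D - C) \<le> volume_dist C D"
      unfolding volume_dist_def using f s
      by (auto intro!: measure_mono_fmeasurable fmeasurable.Un fmeasurable_Diff)
    have "a \<le> measure lborel D + measure lborel (C - D)"
    proof -
      have "measure lborel (C \<inter> D) \<le> measure lborel D"
        using f s by (intro measure_mono_fmeasurable) auto
      then show ?thesis using measure_Int_plus_Diff[OF f(1) s(2)] by (simp add: a_def)
    qed
    then have d: "a / 2 \<le> measure lborel D" using v V by (simp add: \<delta>_def)
    have final: "L * sqrt (x / y) < \<epsilon>" if "x \<le> volume_dist C D" "a / 2 \<le> y" for x y
    proof -
      have "x < y * (\<epsilon> / L)\<^sup>2"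
        using that V mult_right_mono[OF that(2), of "(\<epsilon> / L)\<^sup>2"] by (simp add: \<delta>_def)
      then have "x / y < (\<epsilon> / L)\<^sup>2" using that a by (simp add: divide_less_eq mult.commute)
      then have "sqrt (x / y) < \<epsilon> / L"
        using \<open>0 < \<epsilon>\<close> L by (intro real_less_lsqrt) auto
      then show ?thesis using L by (simp add: field_simps)
    qed
    show "wasserstein_dist C D < \<epsilon>"
    \<comment> \<open>The transport bound starts from the larger body, so the roles are exchanged
      when \<open>D\<close> is larger.\<close>
    proof (cases "measure lborel D \<le> measure lborel C")
      case True
      have "wasserstein_dist C D \<le> L * sqrt (measure lborel (C - D) / measure lborel C)"
        by (rule wasserstein_dist_le[OF C D True]) (use LL L in auto)
      also have "\<dots> < \<epsilon>" using v a by (intro final) (auto simp: a_def)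
      finally show ?thesis .
    next
      case False
      have "wasserstein_dist D C \<le> L * sqrt (measure lborel (D - C) / measure lborel D)"
        by (rule wasserstein_dist_le[OF D C]) (use LL L False in auto)
      also have "\<dots> < \<epsilon>" using v d by (intro final) auto
      finally show ?thesis by (simp add: wasserstein_dist_commute)
    qed
  qed
qed

section \<open>Comparison of the topologies\<close>

text \<open>Openness is tested at one centre at a time, so \<delta> may depend on \<open>x\<close>;
  this is why all estimates above fix the body \<open>C\<close>.\<close>

lemma openin_metric_topology_finer:
  assumes "\<And>x \<epsilon>. x \<in> M \<Longrightarrow> 0 < \<epsilon> \<Longrightarrow> \<exists>\<delta>>0. \<forall>y\<in>M. d x y < \<delta> \<longrightarrow> d' x y < \<epsilon>"
    and "openin (metric_topology M d') U"
  shows "openin (metric_topology M d) U"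
  unfolding openin_metric_topology
proof (intro conjI ballI)
  show "U \<subseteq> M" using assms(2) by (simp add: openin_metric_topology)
  fix x assume "x \<in> U"
  then obtain \<epsilon> where \<epsilon>: "0 < \<epsilon>" "{y\<in>M. d' x y < \<epsilon>} \<subseteq> U" and "x \<in> M"
    using assms(2) unfolding openin_metric_topology by blast
  then obtain \<delta> where "0 < \<delta>" "\<forall>y\<in>M. d x y < \<delta> \<longrightarrow> d' x y < \<epsilon>"
    using assms(1) by blast
  with \<epsilon> show "\<exists>r>0. {y\<in>M. d x y < r} \<subseteq> U" by blast
qed

theorem theorem1:
  shows "metric_topology (convex_bodies :: (real ^ 'n) set set) wasserstein_dist
           = metric_topology convex_bodies volume_dist
       \<and> metric_topology (convex_bodies :: (real ^ 'n) set set) volume_dist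
           = metric_topology convex_bodies hausdorff_dist"
proof -
  let ?M = "convex_bodies :: (real ^ 'n) set set"
  \<comment> \<open>Three inclusions form a cycle: Wasserstein-open sets are volume-open,
    volume-open sets are Hausdorff-open, and Hausdorff-open sets are Wasserstein-open.\<close>
  have 1: "openin (metric_topology ?M volume_dist) U" if "openin (metric_topology ?M wasserstein_dist) U" for U
    using that by (rule openin_metric_topology_finer[rotated])
      (meson wasserstein_dist_less_if_volume_dist_less)
  have 2: "openin (metric_topology ?M hausdorff_dist) U" if "openin (metric_topology ?M volume_dist) U" for U
    using that by (rule openin_metric_topology_finer[rotated])
      (meson volume_dist_less_if_hausdorff_dist_less)
  have 3: "openin (metric_topology ?M wasserstein_dist) U" if "openin (metric_topology ?M hausdorff_dist) U" for U
    using that by (rule openin_metric_topology_finer[rotated])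
      (meson hausdorff_dist_less_if_wasserstein_dist_less)
  from 1 2 3 show ?thesis unfolding topology_eq by blast
qed

end
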